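(* Let $D\subset\mathbb{R}^n$ be a domain, $T\in(0,\infty]$, and let $W:D\times[0,T)\to\mathbb{R}^n$ be a vector field with $W_0(x)=W(x,0)$ satisfying $\|W_0\|_{L^\infty(D)}<\infty$. Suppose $W$ is transported by a family of diffeomorphisms $\{X(\cdot,t)\}_{t\in[0,T)}$ of $D$, with inverses $A(\cdot,t)$, which is volume preserving in the generalized sense that $$\sup_{(a,t)\in D\times[0,T)}|\det(\nabla_aX(a,t))|<\infty .$$ Let $\{(\lambda_j(x,t),e_j(x,t))\}_{j=1}^n$ be the eigenvalue and (orthonormal) eigenvector pairs of the symmetric positive definite matrix $M(x,t)=(\nabla A(x,t))^*\nabla A(x,t)$, ordered so that $\lambda_1\ge\lambda_2\ge\cdots\ge\lambda_n>0$. Suppose there exist a sequence $(x_k,t_k)$ in $D\times[0,T)$ and a point $(\bar x,\bar t)\in\overline{D}\times[0,T]$ such that $\lim_{k\to\infty}(x_k,t_k)=(\bar x,\bar t)$ and $\lim_{k\to\infty}|W(x_k,t_k)|=\infty$. Then necessarily $$\lim_{k\to\infty}\lambda_1(x_k,t_k)=\infty\quad\text{and}\quad\lim_{k\to\infty}\lambda_n(x_k,t_k)=0 .$$ Moreover, let $m$ be the largest number in $\{1,\dots,n\}$ such that $\lim_{k\to\infty}\lambda_j(x_k,t_k)>0$ (the limit existing in $(0,\infty]$) for all $j\in\{1,\dots,m\}$, and let $\Xi(x,t)=W(x,t)/|W(x,t)|$ whenever $|W(x,t)|\ne0$. Then $$\lim_{k\to\infty}e_j(x_k,t_k)\cdot\Xi(x_k,t_k)=0\qquad\text{for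 all }j\in\{1,\dots,m\}.$$
   Context: For every $t\in[0,T)$ the map $a\mapsto X(a,t)$ is a diffeomorphism of $D$ onto itself, and $A(\cdot,t)$ is its inverse: $A(X(a,t),t)=a$, $X(A(x,t),t)=x$ for all $a,x\in D$. $\nabla_aX(a,t)$ and $\nabla A(x,t)$ denote the $n\times n$ Jacobian matrices with respect to the space variable, and $*$ denotes transpose. Definition (transported). A vector field $W:D\times[0,T)\to\mathbb{R}^n$ is transported by $X(\cdot,t)$ if $W(X(a,t),t)=\nabla_aX(a,t)\,W_0(a)$ for all $(a,t)\in D\times[0,T)$, where $W_0(x)=W(x,0)$. If $T=\infty$ and $\bar t=\infty$, the convergence $t_k\to\bar t$ is understood in the extended sense.
   Formalization: The L^∞ norm of W_0 is taken as the supremum over all points of D, not the essential supremum; with the latter the claim fails (X = id, W = W_0 unbounded only on a null set). For continuous W_0 the two agree. *)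

theory Defs
  imports "HOL-Analysis.Analysis"
begin

text \<open>The half-open time interval \<open>[0, T)\<close>, where \<open>T\<close> may be \<open>\<infinity>\<close>.\<close>

definition time_interval :: "ereal \<Rightarrow> real set" where
  "time_interval T = {t. 0 \<le> t \<and> ereal t < T}"

definition C1_on :: "(real ^ 'n) set \<Rightarrow> (real ^ 'n \<Rightarrow> real ^ 'n) \<Rightarrow> bool" where
  "C1_on S f \<longleftrightarrow> (\<forall>x\<in>S. f differentiable (at x)) \<and> continuous_on S (\<lambda>x. jacobian f (at x))"

text \<open>
  \<open>f\<close> is a \<open>C\<^sup>1\<close> diffeomorphism of the open set \<open>S\<close> onto itself and \<open>g\<close> is its inverse.
  As with \<^const>\<open>homeomorphism\<close>, values outside \<open>S\<close> are irrelevant.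
\<close>

definition diffeomorphism_of ::
    "(real ^ 'n) set \<Rightarrow> (real ^ 'n \<Rightarrow> real ^ 'n) \<Rightarrow> (real ^ 'n \<Rightarrow> real ^ 'n) \<Rightarrow> bool" where
  "diffeomorphism_of S f g \<longleftrightarrow> homeomorphism S S f g \<and> C1_on S f \<and> C1_on S g"

definition transported ::
    "(real ^ 'n) set \<Rightarrow> ereal \<Rightarrow> (real ^ 'n \<Rightarrow> real \<Rightarrow> real ^ 'n) \<Rightarrow>
     (real ^ 'n \<Rightarrow> real \<Rightarrow> real ^ 'n) \<Rightarrow> bool" where
  "transported D T X W \<longleftrightarrow>
     (\<forall>a\<in>D. \<forall>t\<in>time_interval T. W (X a t) t = jacobian (\<lambda>b. X b t) (at a) *v W a 0)"

definition gen_volume_preserving ::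
    "(real ^ 'n) set \<Rightarrow> ereal \<Rightarrow> (real ^ 'n \<Rightarrow> real \<Rightarrow> real ^ 'n) \<Rightarrow> bool" where
  "gen_volume_preserving D T X \<longleftrightarrow>
     (SUP (a, t)\<in>D \<times> time_interval T. ereal \<bar>det (jacobian (\<lambda>b. X b t) (at a))\<bar>) < \<infinity>"

text \<open>
  The \<open>L\<^sup>\<infinity>\<close> norm of a pointwise defined field is the supremum over all points of the domain.
  An essential supremum is not meant: the transport law and the blow-up sequence are pointwise,
  and with \<open>X(a,t) = a\<close> a time-independent field that is unbounded only on a null set
  blows up along a sequence although \<open>\<nabla>A\<close> is the identity.
\<close>

definition Linf_norm :: "(real ^ 'n) set \<Rightarrow> (real ^ 'n \<Rightarrow> real ^ 'n) \<Rightarrow> ereal" where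
  "Linf_norm D f = (SUP x\<in>D. ereal (norm (f x)))"

definition deformation_matrix ::
    "(real ^ 'n \<Rightarrow> real \<Rightarrow> real ^ 'n) \<Rightarrow> real ^ 'n \<Rightarrow> real \<Rightarrow> real ^ 'n ^ 'n" where
  "deformation_matrix A x t =
     transpose (jacobian (\<lambda>y. A y t) (at x)) ** jacobian (\<lambda>y. A y t) (at x)"

text \<open>
  \<open>(l j, e j)\<close>, \<open>j = 1, \<dots>, n\<close> with \<open>n = CARD('n)\<close>, are orthonormal eigenpairs of \<open>M\<close>,
  ordered by non-increasing positive eigenvalue. Having \<open>n\<close> orthonormal eigenvectors, each
  eigenvalue occurs according to its multiplicity.
\<close>

definition ordered_eigenpairs ::
    "real ^ 'n ^ 'n \<Rightarrow> (nat \<Rightarrow> real) \<Rightarrow> (nat \<Rightarrow> real ^ 'n) \<Rightarrow> bool" where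
  "ordered_eigenpairs M l e \<longleftrightarrow>
     (\<forall>j\<in>{1..CARD('n)}. M *v e j = l j *\<^sub>R e j) \<and>
     (\<forall>i\<in>{1..CARD('n)}. \<forall>j\<in>{1..CARD('n)}. e i \<bullet> e j = (if i = j then 1 else 0)) \<and>
     (\<forall>i\<in>{1..CARD('n)}. \<forall>j\<in>{1..CARD('n)}. i \<le> j \<longrightarrow> l j \<le> l i) \<and>
     0 < l CARD('n)"

text \<open>The limit of \<open>f\<close> exists in \<open>(0, \<infinity>]\<close>.\<close>

definition has_positive_limit :: "(nat \<Rightarrow> real) \<Rightarrow> bool" where
  "has_positive_limit f \<longleftrightarrow> (\<exists>L::ereal. 0 < L \<and> (\<lambda>k. ereal (f k)) \<longlonglongrightarrow> L)"

definition is_largest :: "nat set \<Rightarrow> nat \<Rightarrow> bool" where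
  "is_largest S m \<longleftrightarrow> m \<in> S \<and> (\<forall>m'\<in>S. m' \<le> m)"

end

(* Since DA W = W_0 along the flow, the quadratic form of M at W equals |W_0|^2. In the
   eigenbasis this bounds sum_j lambda_j (e_j . W)^2, hence also lambda_n |W|^2, so lambda_n -> 0.
   As det M = det(DX)^(-2) stays away from 0 and det M <= lambda_1^(n-1) lambda_n, lambda_1 must
   blow up. Dividing the bound on lambda_j (e_j . W)^2 by |W|^2 gives the claim on directions. *)
theory Submission
  imports Defs
begin

section \<open>Real bounds from finite extended-real suprema\<close>

lemma SUP_ereal_less_top_bound:
  fixes f :: "'a \<Rightarrow> real"
  assumes "(SUP x\<in>S. ereal (f x)) < \<infinity>"
  obtains C where "C > 0" "\<And>x. x \<in> S \<Longrightarrow> f x \<le> C"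
proof -
  obtain r :: nat where r: "(SUP x\<in>S. ereal (f x)) \<le> ereal (real r)"
    using assms less_PInf_Ex_of_nat[of "SUP x\<in>S. ereal (f x)"] by (auto intro: less_imp_le)
  show ?thesis
  proof (rule that)
    \<comment> \<open>The natural number \<open>r\<close> may be 0; adding 1 makes the bound
      strictly positive, so that its square can later stand in a denominator.\<close>
    show "real r + 1 > 0" by simp
    fix x assume "x \<in> S"
    then have "ereal (f x) \<le> (SUP x\<in>S. ereal (f x))" by (rule SUP_upper)
    also note r
    finally have "f x \<le> real r" by (simp only: ereal_less_eq)
    then show "f x \<le> real r + 1" by linarith
  qed
qed

section \<open>Spectral decomposition from ordered eigenpairs\<close>

lemma inner_vector_matrix_mult:
  fixes A :: "real ^ 'n ^ 'm"
  shows "x \<bullet> (y v* A) = (A *v x) \<bullet> y"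
  by (metis dot_lmul_matrix inner_commute)

text \<open>Eigenpairs are numbered by naturals, whereas matrix entries are indexed by the type
  \<open>'n\<close>; \<open>b\<close> is an arbitrary bijection between the two, since only sums and
  products over all indices are read off later. With the eigenvectors as rows of \<open>Q\<close>,
  orthonormality says \<open>Q ** transpose Q = mat 1\<close>, and the eigenvalue equations are the
  columns of \<open>M ** transpose Q = transpose Q ** L\<close>.\<close>

lemma ordered_eigenpairs_diagonalize:
  fixes M :: "real ^ 'n ^ 'n"
  assumes E: "ordered_eigenpairs M l e"
  obtains b Q where "bij_betw b (UNIV :: 'n set) {1..CARD('n)}" "orthogonal_matrix Q"
    "\<And>i. Q $ i = e (b i)" "M = transpose Q ** (\<chi> i j. if i = j then l (b i) else 0) ** Q"
proof -
  obtain b where b: "bij_betw b (UNIV :: 'n set) {1..CARD('n)}"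
    using finite_same_card_bij[of "UNIV :: 'n set" "{1..CARD('n)}"] by auto
  have bin: "b i \<in> {1..CARD('n)}" for i using b by (auto simp: bij_betw_def)
  have binj: "b i = b j \<longleftrightarrow> i = j" for i j using b by (auto simp: bij_betw_def inj_def)
  define Q :: "real ^ 'n ^ 'n" where "Q = (\<chi> i. e (b i))"
  have Qrow: "Q $ i = e (b i)" for i by (simp add: Q_def)
  define L :: "real ^ 'n ^ 'n" where "L = (\<chi> i j. if i = j then l (b i) else 0)"
  have "(Q ** transpose Q) $ i $ j = mat 1 $ i $ j" for i j
  proof -
    have "(Q ** transpose Q) $ i $ j = e (b i) \<bullet> e (b j)"
      by (simp add: matrix_matrix_mult_def transpose_def Qrow inner_vec_def)
    then show ?thesis
      using E bin by (simp add: ordered_eigenpairs_def mat_def binj)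
  qed
  then have QQ: "Q ** transpose Q = mat 1" by (simp add: vec_eq_iff)
  then have QtQ: "transpose Q ** Q = mat 1" by (simp add: matrix_left_right_inverse)
  have "(M ** transpose Q) $ i $ j = (transpose Q ** L) $ i $ j" for i j
  proof -
    have "(M ** transpose Q) $ i $ j = (M *v e (b j)) $ i"
      by (simp add: matrix_matrix_mult_def matrix_vector_mult_def transpose_def Qrow)
    also have "\<dots> = l (b j) * e (b j) $ i"
      using E bin by (simp add: ordered_eigenpairs_def)
    also have "\<dots> = (transpose Q ** L) $ i $ j"
      by (simp add: matrix_matrix_mult_def transpose_def Qrow L_def if_distrib cong: if_cong)
    finally show ?thesis .
  qed
  then have "M ** transpose Q = transpose Q ** L" by (simp add: vec_eq_iff)
  then have "M ** (transpose Q ** Q) = transpose Q ** L ** Q"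
    by (simp add: matrix_mul_assoc)
  then have "M = transpose Q ** L ** Q" by (simp add: QtQ)
  then show ?thesis using that[OF b _ Qrow] QtQ QQ
    by (simp add: orthogonal_matrix_def L_def)
qed

text \<open>The orthogonal factor enters twice and its determinant squares to 1, so only the
  diagonal factor counts.\<close>

lemma det_ordered_eigenpairs:
  fixes M :: "real ^ 'n ^ 'n"
  assumes E: "ordered_eigenpairs M l e"
  shows "det M = (\<Prod>j\<in>{1..CARD('n)}. l j)"
proof -
  obtain b Q where b: "bij_betw b (UNIV :: 'n set) {1..CARD('n)}" and Q: "orthogonal_matrix Q"
    and "\<And>i. Q $ i = e (b i)"
    and M: "M = transpose Q ** (\<chi> i j. if i = j then l (b i) else 0) ** Q"
    by (rule ordered_eigenpairs_diagonalize[OF E]) (rule that)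
  have "det Q * det Q = 1"
    using det_orthogonal_matrix[OF Q] by auto
  then have "det M = det (\<chi> i j::'n. if i = j then l (b i) else 0)"
    by (simp add: M det_mul mult.commute mult.left_commute)
  also have "\<dots> = (\<Prod>i\<in>UNIV. l (b i))"
    by (subst det_diagonal) auto
  also have "\<dots> = (\<Prod>j\<in>{1..CARD('n)}. l j)"
    by (rule prod.reindex_bij_betw[OF b])
  finally show ?thesis .
qed

text \<open>The coordinates of \<open>v\<close> in the eigenbasis are the entries of
  \<open>Q *v v\<close>, and in these coordinates \<open>M\<close> acts diagonally. The second
  identity is Parseval's.\<close>

lemma quadratic_form_ordered_eigenpairs:
  fixes M :: "real ^ 'n ^ 'n"
  assumes E: "ordered_eigenpairs M l e"
  shows "v \<bullet> (M *v v) = (\<Sum>j\<in>{1..CARD('n)}. l j * (e j \<bullet> v)\<^sup>2)"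
    and "v \<bullet> v = (\<Sum>j\<in>{1..CARD('n)}. (e j \<bullet> v)\<^sup>2)"
proof -
  obtain b Q where b: "bij_betw b (UNIV :: 'n set) {1..CARD('n)}" and Q: "orthogonal_matrix Q"
    and Qrow: "\<And>i. Q $ i = e (b i)"
    and M: "M = transpose Q ** (\<chi> i j. if i = j then l (b i) else 0) ** Q"
    by (rule ordered_eigenpairs_diagonalize[OF E]) (rule that)
  let ?L = "(\<chi> i j. if i = j then l (b i) else 0) :: real ^ 'n ^ 'n"
  have Qv: "(Q *v v) $ i = e (b i) \<bullet> v" for i
    by (simp add: matrix_vector_mult_def Qrow inner_vec_def)
  have Lw: "(?L *v w) $ i = l (b i) * w $ i" for w i
    by (simp add: matrix_vector_mult_def if_distrib[of "\<lambda>x. x * _"] cong: if_cong)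
  have "M *v v = transpose Q *v (?L *v (Q *v v))"
    by (simp add: M matrix_vector_mul_assoc matrix_mul_assoc)
  \<comment> \<open>The product \<open>transpose Q *v y\<close> is rewritten to
    \<open>y v* Q\<close>, so \<open>inner_vector_matrix_mult\<close> is the adjoint law that moves
    \<open>Q\<close> to the left factor.\<close>
  then have "v \<bullet> (M *v v) = (Q *v v) \<bullet> (?L *v (Q *v v))"
    by (simp add: inner_vector_matrix_mult)
  also have "\<dots> = (\<Sum>i\<in>UNIV. l (b i) * (e (b i) \<bullet> v)\<^sup>2)"
    by (simp add: inner_vec_def[of "Q *v v"] Lw Qv power2_eq_square mult_ac)
  also have "\<dots> = (\<Sum>j\<in>{1..CARD('n)}. l j * (e j \<bullet> v)\<^sup>2)"
    by (rule sum.reindex_bij_betw[OF b, of "\<lambda>j. l j * (e j \<bullet> v)\<^sup>2"])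
  finally show "v \<bullet> (M *v v) = (\<Sum>j\<in>{1..CARD('n)}. l j * (e j \<bullet> v)\<^sup>2)" .
  have "v = transpose Q *v (Q *v v)"
    using Q by (simp add: matrix_vector_mul_assoc orthogonal_matrix_def)
  then have "v \<bullet> v = (Q *v v) \<bullet> (Q *v v)"
    by (metis inner_vector_matrix_mult transpose_matrix_vector)
  also have "\<dots> = (\<Sum>i\<in>UNIV. (e (b i) \<bullet> v)\<^sup>2)"
    by (simp add: inner_vec_def[of "Q *v v"] Qv power2_eq_square)
  also have "\<dots> = (\<Sum>j\<in>{1..CARD('n)}. (e j \<bullet> v)\<^sup>2)"
    by (rule sum.reindex_bij_betw[OF b, of "\<lambda>j. (e j \<bullet> v)\<^sup>2"])
  finally show "v \<bullet> v = (\<Sum>j\<in>{1..CARD('n)}. (e j \<bullet> v)\<^sup>2)" .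
qed

lemma ordered_eigenpairs_pos:
  fixes M :: "real ^ 'n ^ 'n"
  assumes E: "ordered_eigenpairs M l e" and j: "j \<in> {1..CARD('n)}"
  shows "0 < l j" "l CARD('n) \<le> l j" "l j \<le> l 1"
proof -
  have mono: "l k \<le> l i" if "1 \<le> i" "i \<le> k" "k \<le> CARD('n)" for i k
    using E that by (auto simp: ordered_eigenpairs_def)
  show "l CARD('n) \<le> l j" "l j \<le> l 1"
    using j mono[of j "CARD('n)"] mono[of 1 j] by auto
  then show "0 < l j" using E by (auto simp: ordered_eigenpairs_def)
qed

text \<open>In the product of all eigenvalues the last factor is kept and each of the other n - 1 is
  raised to the largest one.\<close>

lemma det_le_ordered_eigenpairs:
  fixes M :: "real ^ 'n ^ 'n"
  assumes E: "ordered_eigenpairs M l e"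
  shows "det M \<le> l 1 ^ (CARD('n) - 1) * l CARD('n)"
proof -
  let ?n = "CARD('n)"
  have n: "1 \<le> ?n" by (simp add: Suc_leI)
  have "{1..?n} = insert ?n {1..<?n}" using n by auto
  then have "det M = l ?n * (\<Prod>j\<in>{1..<?n}. l j)"
    by (simp add: det_ordered_eigenpairs[OF E])
  also have "\<dots> \<le> l ?n * (\<Prod>j\<in>{1..<?n}. l 1)"
    using ordered_eigenpairs_pos[OF E] n
    by (intro mult_left_mono prod_mono conjI) (auto simp: less_imp_le)
  finally show ?thesis by (simp add: mult.commute)
qed

section \<open>Jacobians of mutually inverse maps\<close>

lemma diffeomorphism_of_jacobian_inverse:
  fixes f g :: "real ^ 'n \<Rightarrow> real ^ 'n"
  assumes d: "diffeomorphism_of S f g" and S: "open S" and x: "x \<in> S"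
  shows "jacobian g (at (f x)) ** jacobian f (at x) = mat 1"
proof -
  have fx: "f x \<in> S" and gf: "\<And>y. y \<in> S \<Longrightarrow> g (f y) = y"
    using d x by (auto simp: diffeomorphism_of_def homeomorphism_def)
  have df: "(f has_derivative ((*v) (jacobian f (at x)))) (at x)"
    using d x by (simp add: diffeomorphism_of_def C1_on_def jacobian_works)
  have dg: "(g has_derivative ((*v) (jacobian g (at (f x))))) (at (f x))"
    using d fx by (simp add: diffeomorphism_of_def C1_on_def jacobian_works)
  \<comment> \<open>The composite of \<open>g\<close> after \<open>f\<close> is the identity only on
    \<open>S\<close>; as \<open>S\<close> is open, this is a neighbourhood of \<open>x\<close>, and
    uniqueness of the derivative there identifies the chain-rule product with the identity.\<close>
  have "((\<lambda>y. y) has_derivative ((*v) (jacobian g (at (f x))) \<circ> (*v) (jacobian f (at x)))) (at x)"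
    using has_derivative_transform_within_open[OF diff_chain_at[OF df dg] S x] gf by simp
  then have "(*v) (jacobian g (at (f x))) \<circ> (*v) (jacobian f (at x)) = (\<lambda>y. y)"
    using has_derivative_unique[OF _ has_derivative_ident] by blast
  then have "(jacobian g (at (f x)) ** jacobian f (at x)) *v v = mat 1 *v v" for v
    by (simp add: fun_eq_iff flip: matrix_vector_mul_assoc)
  then show ?thesis by (simp add: matrix_eq)
qed

theorem theorem1p1:
  fixes D :: "(real ^ 'n) set"
    and T :: ereal
    and W X A :: "real ^ 'n \<Rightarrow> real \<Rightarrow> real ^ 'n"
    and lam :: "nat \<Rightarrow> real ^ 'n \<Rightarrow> real \<Rightarrow> real"
    and e :: "nat \<Rightarrow> real ^ 'n \<Rightarrow> real \<Rightarrow> real ^ 'n"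
    and \<Xi> :: "real ^ 'n \<Rightarrow> real \<Rightarrow> real ^ 'n"
    and xs :: "nat \<Rightarrow> real ^ 'n" and ts :: "nat \<Rightarrow> real"
    and xbar :: "real ^ 'n" and tbar :: ereal
  assumes domain: "open D" "connected D" "D \<noteq> {}"
    and T: "0 < T"
    and W0: "Linf_norm D (\<lambda>x. W x 0) < \<infinity>"
    and diffeo: "\<forall>t\<in>time_interval T. diffeomorphism_of D (\<lambda>a. X a t) (\<lambda>x. A x t)"
    and transp: "transported D T X W"
    and vol: "gen_volume_preserving D T X"
    and eigen: "\<forall>x\<in>D. \<forall>t\<in>time_interval T.
      ordered_eigenpairs (deformation_matrix A x t) (\<lambda>j. lam j x t) (\<lambda>j. e j x t)"
    and seq: "\<forall>k. xs k \<in> D \<and> ts k \<in> time_interval T"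
    and bar: "xbar \<in> closure D" "0 \<le> tbar" "tbar \<le> T"
    and lim_x: "xs \<longlonglongrightarrow> xbar"
    and lim_t: "(\<lambda>k. ereal (ts k)) \<longlonglongrightarrow> tbar"
    and blowup: "filterlim (\<lambda>k. norm (W (xs k) (ts k))) at_top sequentially"
    and Xi: "\<forall>x\<in>D. \<forall>t\<in>time_interval T. W x t \<noteq> 0 \<longrightarrow> \<Xi> x t = W x t /\<^sub>R norm (W x t)"
  shows "filterlim (\<lambda>k. lam 1 (xs k) (ts k)) at_top sequentially \<and>
    (\<lambda>k. lam CARD('n) (xs k) (ts k)) \<longlonglongrightarrow> 0 \<and>
    (\<exists>m. is_largest {m \<in> {1..CARD('n)}. \<forall>j\<in>{1..m}. has_positive_limit (\<lambda>k. lam j (xs k) (ts k))} m \<and>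
      (\<forall>j\<in>{1..m}. (\<lambda>k. e j (xs k) (ts k) \<bullet> \<Xi> (xs k) (ts k)) \<longlonglongrightarrow> 0))"
proof -
  let ?n = "CARD('n)"
  define w where "w k = W (xs k) (ts k)" for k
  define l where "l j k = lam j (xs k) (ts k)" for j k
  define f where "f j k = e j (xs k) (ts k)" for j k
  define M where "M k = deformation_matrix A (xs k) (ts k)" for k
  have n: "1 \<le> ?n" by (simp add: Suc_leI)
  have E: "ordered_eigenpairs (M k) (\<lambda>j. l j k) (\<lambda>j. f j k)" for k
    using eigen seq by (simp add: M_def l_def f_def)
  note pos = ordered_eigenpairs_pos[OF E]
  obtain C where C: "C > 0" "\<And>x. x \<in> D \<Longrightarrow> norm (W x 0) \<le> C"
    using W0 unfolding Linf_norm_def by (rule SUP_ereal_less_top_bound) blast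
  obtain B where B: "B > 0"
    "\<And>a t. a \<in> D \<Longrightarrow> t \<in> time_interval T \<Longrightarrow> \<bar>det (jacobian (\<lambda>b. X b t) (at a))\<bar> \<le> B"
  proof (rule SUP_ereal_less_top_bound[where S = "D \<times> time_interval T"
        and f = "\<lambda>(a, t). \<bar>det (jacobian (\<lambda>b. X b t) (at a))\<bar>"])
    show "(SUP p\<in>D \<times> time_interval T.
        ereal (case p of (a, t) \<Rightarrow> \<bar>det (jacobian (\<lambda>b. X b t) (at a))\<bar>)) < \<infinity>"
      using vol by (simp add: gen_volume_preserving_def case_prod_unfold)
  qed (use that in force)

  \<comment> \<open>Bounds for the deformation matrix along the sequence\<close>
  have key: "w k \<bullet> (M k *v w k) \<le> C\<^sup>2 \<and> det (M k) \<ge> 1 / B\<^sup>2" for k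
  proof -
    let ?x = "xs k" and ?t = "ts k"
    \<comment> \<open>The label \<open>?a\<close> is the point that the flow carries to
      \<open>?x\<close> at time \<open>?t\<close>. The transport law at \<open>?a\<close> expresses
      \<open>w k\<close> through \<open>?J\<close>, and \<open>?K\<close> undoes \<open>?J\<close>,
      which leaves the bounded initial field.\<close>
    let ?a = "A ?x ?t"
    let ?J = "jacobian (\<lambda>b. X b ?t) (at ?a)" and ?K = "jacobian (\<lambda>y. A y ?t) (at ?x)"
    have xt: "?x \<in> D" "?t \<in> time_interval T" using seq by auto
    have d: "diffeomorphism_of D (\<lambda>a. X a ?t) (\<lambda>x. A x ?t)" using diffeo xt by blast
    have a: "?a \<in> D" "X ?a ?t = ?x"
      using d xt by (auto simp: diffeomorphism_of_def homeomorphism_def)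
    have KJ: "?K ** ?J = mat 1"
      using diffeomorphism_of_jacobian_inverse[OF d domain(1) a(1)] by (simp add: a(2))
    have "w k = ?J *v W ?a 0"
      using transp a xt unfolding transported_def w_def by metis
    then have Kw: "?K *v w k = W ?a 0"
      by (simp add: matrix_vector_mul_assoc KJ)
    have "w k \<bullet> (M k *v w k) = (?K *v w k) \<bullet> (?K *v w k)"
      by (simp add: M_def deformation_matrix_def inner_vector_matrix_mult
          flip: matrix_vector_mul_assoc)
    also have "\<dots> = (norm (W ?a 0))\<^sup>2" by (simp add: Kw power2_norm_eq_inner)
    also have "\<dots> \<le> C\<^sup>2" using C(2)[OF a(1)] by (simp add: power_mono)
    finally have 1: "w k \<bullet> (M k *v w k) \<le> C\<^sup>2" .
    \<comment> \<open>The determinants are reciprocal, so the upper bound \<open>B\<close> for the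
      flow becomes a lower bound for \<open>det (M k)\<close>, which is the square of
      \<open>det ?K\<close>.\<close>
    have "det ?K * det ?J = 1" using arg_cong[OF KJ, of det] by (simp add: det_mul)
    then have "(det ?K)\<^sup>2 * (det ?J)\<^sup>2 = 1" by (metis power_mult_distrib power_one)
    then have "(det ?K)\<^sup>2 = 1 / (det ?J)\<^sup>2" by (metis mult_zero_right nonzero_eq_divide_eq zero_neq_one)
    moreover have "(det ?J)\<^sup>2 \<le> B\<^sup>2"
      using B(2)[OF a(1) xt(2)] by (metis abs_ge_zero power2_abs power_mono)
    moreover have "(det ?J)\<^sup>2 > 0" using \<open>det ?K * det ?J = 1\<close> by auto
    ultimately have "(det ?K)\<^sup>2 \<ge> 1 / B\<^sup>2" by (simp add: frac_le)
    then have "det (M k) \<ge> 1 / B\<^sup>2"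
      by (simp add: M_def deformation_matrix_def det_mul power2_eq_square)
    with 1 show ?thesis by blast
  qed

  \<comment> \<open>Estimates in the eigenbasis\<close>
  have comp: "l j k * (f j k \<bullet> w k)\<^sup>2 \<le> C\<^sup>2" if j: "j \<in> {1..?n}" for j k
  proof -
    have "l j k * (f j k \<bullet> w k)\<^sup>2 \<le> (\<Sum>j\<in>{1..?n}. l j k * (f j k \<bullet> w k)\<^sup>2)"
      using j pos(1) by (intro member_le_sum) (auto simp: less_imp_le)
    then show ?thesis
      using key[of k] by (simp add: quadratic_form_ordered_eigenpairs(1)[OF E])
  qed
  \<comment> \<open>Parseval splits the squared norm into components, and the common weight
    \<open>l ?n k\<close> is then raised to \<open>l j k\<close> in each of them.\<close>
  have low: "l ?n k * (norm (w k))\<^sup>2 \<le> C\<^sup>2" for k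
  proof -
    have "l ?n k * (norm (w k))\<^sup>2 = (\<Sum>j\<in>{1..?n}. l ?n k * (f j k \<bullet> w k)\<^sup>2)"
      unfolding power2_norm_eq_inner quadratic_form_ordered_eigenpairs(2)[OF E, of "w k" k]
        sum_distrib_left ..
    also have "\<dots> \<le> (\<Sum>j\<in>{1..?n}. l j k * (f j k \<bullet> w k)\<^sup>2)"
      using pos(2) by (intro sum_mono mult_right_mono) auto
    finally show ?thesis
      using key[of k] by (simp add: quadratic_form_ordered_eigenpairs(1)[OF E])
  qed
  have wlim: "filterlim (\<lambda>k. norm (w k)) at_top sequentially"
    using blowup by (simp add: w_def)
  \<comment> \<open>Both the divisions below and the formula for \<open>\<Xi>\<close>, which is
    prescribed only where the field is nonzero, are available from some index on.\<close>
  have wpos: "\<forall>\<^sub>F k in sequentially. norm (w k) > 0"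
    using wlim unfolding filterlim_at_top_dense by blast
  have "filterlim (\<lambda>k. (norm (w k))\<^sup>2) at_top sequentially"
    by (rule filterlim_pow_at_top[OF _ wlim]) simp
  then have Clim: "(\<lambda>k. c / (norm (w k))\<^sup>2) \<longlonglongrightarrow> 0" for c :: real
    using tendsto_divide_0[OF tendsto_const] filterlim_at_top_imp_at_infinity by blast

  \<comment> \<open>Limits of the smallest and the largest eigenvalue\<close>
  have ln0: "l ?n \<longlonglongrightarrow> 0"
  proof (rule tendsto_sandwich[OF _ _ tendsto_const Clim])
    show "\<forall>\<^sub>F k in sequentially. 0 \<le> l ?n k" using pos(1) n by (auto simp: less_imp_le)
    show "\<forall>\<^sub>F k in sequentially. l ?n k \<le> C\<^sup>2 / (norm (w k))\<^sup>2"
      using wpos by eventually_elim (use low in \<open>simp add: pos_le_divide_eq\<close>)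
  qed
  have l1: "filterlim (l 1) at_top sequentially"
  proof (subst filterlim_at_top_gt[where c = 0], intro allI impI)
    fix Z :: real assume Z: "0 < Z"
    \<comment> \<open>The threshold is chosen so that \<open>l 1 k < Z\<close> would force the
      determinant below \<open>1 / B\<^sup>2\<close>. For n = 1 the power of \<open>Z\<close> is 1
      and the contradiction arises for every \<open>Z\<close>: a blow-up cannot occur in dimension
      one.\<close>
    have "0 < 1 / (B\<^sup>2 * Z ^ (?n - 1))" using Z B(1) by simp
    then have "\<forall>\<^sub>F k in sequentially. l ?n k < 1 / (B\<^sup>2 * Z ^ (?n - 1))"
      using order_tendstoD(2)[OF ln0] by blast
    then show "\<forall>\<^sub>F k in sequentially. Z \<le> l 1 k"
    proof eventually_elim
      case (elim k)
      show ?case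
      proof (rule ccontr)
        assume "\<not> Z \<le> l 1 k"
        moreover have "0 < l 1 k" "0 < l ?n k" using pos(1) n by auto
        ultimately have "l 1 k ^ (?n - 1) * l ?n k \<le> Z ^ (?n - 1) * l ?n k"
          by (intro mult_right_mono power_mono) auto
        also have "\<dots> < Z ^ (?n - 1) * (1 / (B\<^sup>2 * Z ^ (?n - 1)))"
          using elim Z by (intro mult_strict_left_mono) auto
        also have "\<dots> = 1 / B\<^sup>2" using Z by simp
        finally show False
          using det_le_ordered_eigenpairs[OF E, of k] key[of k] by simp
      qed
    qed
  qed

  \<comment> \<open>Asymptotic orthogonality of the direction field\<close>
  have dir: "(\<lambda>k. f j k \<bullet> \<Xi> (xs k) (ts k)) \<longlonglongrightarrow> 0"
    if j: "j \<in> {1..?n}" and lim: "has_positive_limit (l j)" for j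
  proof -
    obtain L :: ereal where L: "0 < L" "(\<lambda>k. ereal (l j k)) \<longlonglongrightarrow> L"
      using lim by (auto simp: has_positive_limit_def)
    \<comment> \<open>A real \<open>d\<close> strictly between 0 and \<open>L\<close> exists also
      when \<open>L\<close> is infinite; it bounds \<open>l j k\<close> from below eventually, so a
      finite and an infinite limit need no separate treatment.\<close>
    obtain d where d: "0 < ereal d" "ereal d < L" using ereal_dense2[OF L(1)] by blast
    have ev: "\<forall>\<^sub>F k in sequentially. ereal d < ereal (l j k)"
      by (rule order_tendstoD(1)[OF L(2) d(2)])
    \<comment> \<open>The squares are treated because \<open>comp\<close> is quadratic; the limit 0
      passes back to the inner products.\<close>
    have "(\<lambda>k. (f j k \<bullet> \<Xi> (xs k) (ts k))\<^sup>2) \<longlonglongrightarrow> 0"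
    proof (rule tendsto_sandwich[OF _ _ tendsto_const Clim])
      show "\<forall>\<^sub>F k in sequentially. 0 \<le> (f j k \<bullet> \<Xi> (xs k) (ts k))\<^sup>2" by simp
      show "\<forall>\<^sub>F k in sequentially. (f j k \<bullet> \<Xi> (xs k) (ts k))\<^sup>2 \<le> C\<^sup>2 / d / (norm (w k))\<^sup>2"
        using ev wpos
      proof eventually_elim
        case (elim k)
        have "\<Xi> (xs k) (ts k) = w k /\<^sub>R norm (w k)" using Xi seq elim by (simp add: w_def)
        then have eq: "(f j k \<bullet> \<Xi> (xs k) (ts k))\<^sup>2 = (f j k \<bullet> w k)\<^sup>2 / (norm (w k))\<^sup>2"
          by (simp add: power_mult_distrib power_inverse divide_inverse mult.commute)
        have "d * (f j k \<bullet> w k)\<^sup>2 \<le> l j k * (f j k \<bullet> w k)\<^sup>2"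
          using elim by (intro mult_right_mono) auto
        then have "(f j k \<bullet> w k)\<^sup>2 \<le> C\<^sup>2 / d"
          using comp[OF j, of k] d(1) by (simp add: pos_le_divide_eq mult.commute)
        then show ?case unfolding eq by (rule divide_right_mono) simp
      qed
    qed
    then show ?thesis by simp
  qed

  \<comment> \<open>Existence of the largest index and conclusion\<close>
  let ?S = "{m \<in> {1..?n}. \<forall>j\<in>{1..m}. has_positive_limit (l j)}"
  have "has_positive_limit (l 1)"
    using l1 by (auto simp: has_positive_limit_def tendsto_PInfty_eq_at_top intro!: exI[of _ \<infinity>])
  then have "1 \<in> ?S" using n by auto
  then have "?S \<noteq> {}" by blast
  have "finite ?S" by simp
  then have mS: "Max ?S \<in> ?S" using \<open>?S \<noteq> {}\<close> by (rule Max_in)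
  obtain m where m: "is_largest ?S m"
    unfolding is_largest_def using mS Max_ge[OF \<open>finite ?S\<close>] by blast
  then have mn: "m \<in> {1..?n}" and ml: "\<forall>j\<in>{1..m}. has_positive_limit (l j)"
    unfolding is_largest_def by blast+
  have "(\<lambda>k. f j k \<bullet> \<Xi> (xs k) (ts k)) \<longlonglongrightarrow> 0" if "j \<in> {1..m}" for j
    using dir[of j] mn ml that by simp
  with m have "\<exists>m. is_largest ?S m \<and> (\<forall>j\<in>{1..m}. (\<lambda>k. f j k \<bullet> \<Xi> (xs k) (ts k)) \<longlonglongrightarrow> 0)"
    by blast
  with l1 ln0 have "filterlim (l 1) at_top sequentially \<and> l ?n \<longlonglongrightarrow> 0 \<and>
    (\<exists>m. is_largest ?S m \<and> (\<forall>j\<in>{1..m}. (\<lambda>k. f j k \<bullet> \<Xi> (xs k) (ts k)) \<longlonglongrightarrow> 0))"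
    by blast
  \<comment> \<open>In terms such as \<open>l 1\<close> the argument \<open>k\<close> is absent, so
    \<open>l\<close> is replaced through an equation between functions.\<close>
  moreover have "l = (\<lambda>j k. lam j (xs k) (ts k))" by (simp add: l_def fun_eq_iff)
  ultimately show ?thesis by (simp only: f_def)
qed

end
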